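(* Let $(X,d)$ be a compact metric space, $f:X\to X$ a homeomorphism, $p>0$, and $\pi_0$ an ergodic $f$-invariant Borel probability measure on $X$. Assume that only periodic finite-memory coding and estimation policies are admitted, i.e. policies for which there exists an integer $\tau>0$ such that the coder is of the form $q_t=\delta_t(x_{[t-\tau+1,t]})$ with $\delta_{t+\tau}\equiv\delta_t$, and the estimator is of the form $\hat{x}_t=\gamma_t(q_{[t-\tau+1,t]})$ with $\gamma_{t+\tau}\equiv\gamma_t$. Let $C_0$ be the smallest channel capacity above which the objective (E3) of asymptotic estimation in expectation (with exponent $p$) can be achieved for every $\varepsilon>0$ by such policies. Then $$C_0\ \ge\ h_{\pi_0}(f).$$
   Context: All logarithms are to base $2$. The system is $x_{t+1}=f(x_t)$, $t\in\mathbb{Z}$, with random initial state $x_0$ distributed according to $\pi_0$; thus $x_t=f^t(x_0)$ for all $t\in\mathbb{Z}$. For a sequence $(a_t)$ and integers $s\le t$, $a_{[s,t]}=(a_s,a_{s+1},\dots,a_t)$. Admissible policies: given a finite nonempty alphabet $\mathcal{M}$ (noiseless channel of capacity $C=\log|\mathcal{M}|$), an admissible policy consists of an integer $\tau>0$ (which may depend on the policy), measurable maps $\delta_t:X^\tau\to\mathcal{M}$ and maps $\gamma_t:\mathcal{M}^\tau\to X$ with $\delta_{t+\tau}=\delta_t$ and $\gamma_{t+\tau}=\gamma_t$ for all $t$. These maps are indexed by $t\in\mathbb{Z}$ via periodicity. For initial state $x_0$, $q_t=\delta_t(x_{t-\tau+1},\dots,x_t)$ and $\hat{x}_t=\hat{x}_t(x_0)=\gamma_t(q_{t-\tau+1},\dots,q_t)$.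 Objective (E3) for a given $\varepsilon>0$: $\limsup_{t\to\infty}\int_X d(f^t(x_0),\hat{x}_t(x_0))^p\,\pi_0(\mathrm{d}x_0)\le\varepsilon$. $C_0$: for $\varepsilon>0$ let $C_\varepsilon$ be the infimum of $\log|\mathcal{M}|$ over all finite alphabets $\mathcal{M}$ for which there is an admissible policy achieving the objective for this $\varepsilon$ (with $\inf\emptyset=\infty$); then $C_0:=\lim_{\varepsilon\downarrow0}C_\varepsilon\in[0,\infty]$. Metric entropy: for a finite Borel partition $\mathcal{P}$ of $X$, $\mathcal{P}^n:=\bigvee_{i=0}^{n-1}f^{-i}\mathcal{P}$, $H_{\pi_0}(\mathcal{P}^n)=-\sum_{P\in\mathcal{P}^n}\pi_0(P)\log\pi_0(P)$, $h_{\pi_0}(f;\mathcal{P}):=\lim_{n\to\infty}\frac1nH_{\pi_0}(\mathcal{P}^n)$, and $h_{\pi_0}(f):=\sup_{\mathcal{P}}h_{\pi_0}(f;\mathcal{P})\in[0,\infty]$ over all finite Borel partitions. *)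

theory Defs
  imports "HOL-Probability.Probability"
begin

section \<open>Ergodicity and metric entropy\<close>

text \<open>Invertible systems are given by a bijection \<open>f\<close>; this is \<open>f\<^sup>t\<close> for an integer \<open>t\<close>.\<close>

definition int_iterate :: "('a \<Rightarrow> 'a) \<Rightarrow> int \<Rightarrow> 'a \<Rightarrow> 'a" where
  "int_iterate f t = (if 0 \<le> t then f ^^ nat t else inv f ^^ nat (- t))"

definition invariant_measure :: "('a \<Rightarrow> 'a) \<Rightarrow> 'a measure \<Rightarrow> bool" where
  "invariant_measure f M \<longleftrightarrow> f \<in> measurable M M \<and> distr M M f = M"

definition ergodic_measure :: "('a \<Rightarrow> 'a) \<Rightarrow> 'a measure \<Rightarrow> bool" where
  "ergodic_measure f M \<longleftrightarrow> invariant_measure f M \<and>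
     (\<forall>A\<in>sets M. f -` A \<inter> space M = A \<longrightarrow> measure M A = 0 \<or> measure M A = 1)"

definition finite_measurable_partition :: "'a measure \<Rightarrow> 'a set set \<Rightarrow> bool" where
  "finite_measurable_partition M P \<longleftrightarrow> finite P \<and> partition_on (space M) P \<and> P \<subseteq> sets M"

definition pullback_partition :: "('a \<Rightarrow> 'a) \<Rightarrow> nat \<Rightarrow> 'a set set \<Rightarrow> 'a set set" where
  "pullback_partition f i P = (\<lambda>A. (f ^^ i) -` A) ` P"

text \<open>The join of \<open>f\<^sup>-\<^sup>i P\<close> over \<open>i < n\<close>. Since \<open>partition_on\<close> and \<open>common_refinement\<close> both
  discard the empty set, distinct cells of the join are disjoint.\<close>

definition partition_join :: "('a \<Rightarrow> 'a) \<Rightarrow> 'a set set \<Rightarrow> nat \<Rightarrow> 'a set set" where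
  "partition_join f P n = common_refinement ((\<lambda>i. pullback_partition f i P) ` {..<n})"

text \<open>The convention \<open>0 log 0 = 0\<close> holds automatically.\<close>

definition partition_entropy :: "'a measure \<Rightarrow> 'a set set \<Rightarrow> real" where
  "partition_entropy M P = - (\<Sum>A\<in>P. measure M A * log 2 (measure M A))"

definition entropy_wrt_partition :: "'a measure \<Rightarrow> ('a \<Rightarrow> 'a) \<Rightarrow> 'a set set \<Rightarrow> real" where
  "entropy_wrt_partition M f P = lim (\<lambda>n. partition_entropy M (partition_join f P n) / real n)"

definition metric_entropy :: "'a measure \<Rightarrow> ('a \<Rightarrow> 'a) \<Rightarrow> ereal" where
  "metric_entropy M f =
     (SUP P \<in> {P. finite_measurable_partition M P}. ereal (entropy_wrt_partition M f P))"

section \<open>Periodic finite-memory coding and estimation\<close>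

text \<open>The block \<open>(a\<^sub>t\<^sub>-\<^sub>k\<^sub>+\<^sub>1, \<dots>, a\<^sub>t)\<close>, oldest entry at index \<open>0\<close>.\<close>

definition window :: "nat \<Rightarrow> (int \<Rightarrow> 'b) \<Rightarrow> int \<Rightarrow> nat \<Rightarrow> 'b" where
  "window k a t = (\<lambda>i\<in>{..<k}. a (t - int k + 1 + int i))"

text \<open>\<open>\<delta> t\<close> and \<open>\<gamma> t\<close> act on blocks of length \<open>k\<close>, the points of
  \<open>\<Pi>\<^sub>E i\<in>{..<k}. UNIV\<close> and \<open>\<Pi>\<^sub>E i\<in>{..<k}. A\<close>; values elsewhere are irrelevant. For a compact
  (hence second countable) state space, the product of the Borel sigma-algebras used here is
  the Borel sigma-algebra of the product space.\<close>

definition admissible_policy ::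
    "'m set \<Rightarrow> nat \<Rightarrow> (int \<Rightarrow> (nat \<Rightarrow> 'a::topological_space) \<Rightarrow> 'm) \<Rightarrow>
     (int \<Rightarrow> (nat \<Rightarrow> 'm) \<Rightarrow> 'a) \<Rightarrow> bool" where
  "admissible_policy A k \<delta> \<gamma> \<longleftrightarrow> 0 < k \<and>
     (\<forall>t. \<delta> t \<in> measurable (\<Pi>\<^sub>M i\<in>{..<k}. borel) (count_space A)) \<and>
     (\<forall>t. \<delta> (t + int k) = \<delta> t) \<and>
     (\<forall>t. \<gamma> (t + int k) = \<gamma> t)"

definition coded_symbol ::
    "('a \<Rightarrow> 'a) \<Rightarrow> nat \<Rightarrow> (int \<Rightarrow> (nat \<Rightarrow> 'a) \<Rightarrow> 'm) \<Rightarrow> 'a \<Rightarrow> int \<Rightarrow> 'm" where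
  "coded_symbol f k \<delta> x0 t = \<delta> t (window k (\<lambda>s. int_iterate f s x0) t)"

definition state_estimate ::
    "('a \<Rightarrow> 'a) \<Rightarrow> nat \<Rightarrow> (int \<Rightarrow> (nat \<Rightarrow> 'a) \<Rightarrow> 'm) \<Rightarrow> (int \<Rightarrow> (nat \<Rightarrow> 'm) \<Rightarrow> 'a) \<Rightarrow>
     'a \<Rightarrow> int \<Rightarrow> 'a" where
  "state_estimate f k \<delta> \<gamma> x0 t = \<gamma> t (window k (coded_symbol f k \<delta> x0) t)"

definition achieves_objective ::
    "'a::metric_space measure \<Rightarrow> ('a \<Rightarrow> 'a) \<Rightarrow> real \<Rightarrow> real \<Rightarrow> nat \<Rightarrow>
     (int \<Rightarrow> (nat \<Rightarrow> 'a) \<Rightarrow> 'm) \<Rightarrow> (int \<Rightarrow> (nat \<Rightarrow> 'm) \<Rightarrow> 'a) \<Rightarrow> bool" where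
  "achieves_objective M f p \<epsilon> k \<delta> \<gamma> \<longleftrightarrow>
     Limsup (at_top :: int filter)
       (\<lambda>t. \<integral>\<^sup>+ x. ennreal (dist (int_iterate f t x) (state_estimate f k \<delta> \<gamma> x t) powr p) \<partial>M)
     \<le> ennreal \<epsilon>"

text \<open>Every finite alphabet is in bijection with a finite set of natural numbers, so ranging
  over the latter loses nothing.\<close>

definition achieving_alphabet ::
    "'a::metric_space measure \<Rightarrow> ('a \<Rightarrow> 'a) \<Rightarrow> real \<Rightarrow> real \<Rightarrow> nat set \<Rightarrow> bool" where
  "achieving_alphabet M f p \<epsilon> A \<longleftrightarrow> finite A \<and> A \<noteq> {} \<and>
     (\<exists>k \<delta> \<gamma>. admissible_policy A k \<delta> \<gamma> \<and> achieves_objective M f p \<epsilon> k \<delta> \<gamma>)"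

definition min_capacity_eps ::
    "'a::metric_space measure \<Rightarrow> ('a \<Rightarrow> 'a) \<Rightarrow> real \<Rightarrow> real \<Rightarrow> ereal" where
  "min_capacity_eps M f p \<epsilon> =
     (INF A \<in> {A. achieving_alphabet M f p \<epsilon> A}. ereal (log 2 (real (card A))))"

definition min_capacity :: "'a::metric_space measure \<Rightarrow> ('a \<Rightarrow> 'a) \<Rightarrow> real \<Rightarrow> ereal" where
  "min_capacity M f p = Lim (at_right 0) (min_capacity_eps M f p)"

text \<open>The limit defining \<open>min_capacity\<close> always exists.\<close>

lemma achieving_alphabet_mono:
  assumes "achieving_alphabet M f p \<epsilon> A" "\<epsilon> \<le> \<epsilon>'"
  shows "achieving_alphabet M f p \<epsilon>' A"
  using assms unfolding achieving_alphabet_def achieves_objective_def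
  by (meson ennreal_leI order_trans)

lemma min_capacity_eps_antimono:
  "\<epsilon> \<le> \<epsilon>' \<Longrightarrow> min_capacity_eps M f p \<epsilon>' \<le> min_capacity_eps M f p \<epsilon>"
  unfolding min_capacity_eps_def
  by (rule INF_superset_mono) (auto intro: achieving_alphabet_mono)

lemma tendsto_min_capacity:
  "(min_capacity_eps M f p \<longlongrightarrow> min_capacity M f p) (at_right 0)"
proof -
  have "(min_capacity_eps M f p \<longlongrightarrow> (SUP \<epsilon>\<in>{0<..}. min_capacity_eps M f p \<epsilon>)) (at_right 0)"
  proof (rule order_tendstoI)
    fix a assume "a < (SUP \<epsilon>\<in>{0<..}. min_capacity_eps M f p \<epsilon>)"
    then obtain e where e: "e > 0" "a < min_capacity_eps M f p e"
      by (auto simp: less_SUP_iff)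
    have "\<And>\<epsilon>. \<epsilon> < e \<Longrightarrow> a < min_capacity_eps M f p \<epsilon>"
      using e(2) min_capacity_eps_antimono[of _ e M f p] by (meson less_imp_le less_le_trans)
    then show "\<forall>\<^sub>F \<epsilon> in at_right 0. a < min_capacity_eps M f p \<epsilon>"
      using e(1) by (auto simp: eventually_at_right_field)
  next
    fix a assume a: "(SUP \<epsilon>\<in>{0<..}. min_capacity_eps M f p \<epsilon>) < a"
    have "\<And>\<epsilon>. \<epsilon> > 0 \<Longrightarrow> min_capacity_eps M f p \<epsilon> < a"
      using a by (meson SUP_upper greaterThan_iff le_less_trans)
    then show "\<forall>\<^sub>F \<epsilon> in at_right 0. min_capacity_eps M f p \<epsilon> < a"
      by (auto simp: eventually_at_right_field intro: exI[of _ 1])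
  qed
  then show ?thesis
    unfolding min_capacity_def by (simp add: tendsto_Lim)
qed

end

theory Submission
  imports Defs
begin

text \<open>Fix a finite partition \<open>P\<close>. If the estimation error is small on average, then off a set of small
  measure the cell of \<open>P\<close> containing \<open>x\<^sub>t\<close> can be read off the estimate of \<open>x\<^sub>t\<close>: the cells contain
  disjoint compact sets of almost full measure, and these lie at a positive distance from each
  other. The estimates over \<open>n\<close> consecutive times depend on at most \<open>n + \<tau>\<close> channel symbols, so the
  itineraries of length \<open>n\<close> are described, up to a small frequency of wrong letters, by
  \<open>card A ^ (n + \<tau>)\<close> codewords. Bounding entropy by cross entropy with respect to a mixture of
  noisy codewords gives \<open>H(P\<^sup>n) \<le> (n + \<tau>) log (card A) + n \<zeta>\<close> with \<open>\<zeta>\<close> arbitrarily small; by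
  invariance the starting time of the itinerary does not matter.\<close>

section \<open>Entropy of finite-valued maps\<close>

lemma measurable_finite_word:
  fixes n :: nat
  assumes "\<And>i. i < n \<Longrightarrow> X i \<in> measurable M (count_space S)" and "finite S"
  shows "(\<lambda>x. \<lambda>i\<in>{..<n}. X i x) \<in> measurable M (count_space (\<Pi>\<^sub>E i\<in>{..<n}. S))"
proof -
  have "(\<lambda>x. \<lambda>i\<in>{..<n}. X i x) \<in> measurable M (\<Pi>\<^sub>M i\<in>{..<n}. count_space S)"
    using assms by (intro measurable_restrict) auto
  also have "(\<Pi>\<^sub>M i\<in>{..<n}. count_space S) = count_space (\<Pi>\<^sub>E i\<in>{..<n}. S)"
    using assms(2) by (intro count_space_PiM_finite) (simp_all add: countable_finite)
  finally show ?thesis .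
qed

text \<open>Restriction to \<open>{..<n}\<close> puts itineraries into an extensional product, which
  is finite for a finite alphabet.\<close>

definition itinerary :: "('a \<Rightarrow> 'a) \<Rightarrow> ('a \<Rightarrow> 'b) \<Rightarrow> nat \<Rightarrow> 'a \<Rightarrow> nat \<Rightarrow> 'b" where
  "itinerary f \<phi> n x = (\<lambda>i\<in>{..<n}. \<phi> ((f ^^ i) x))"

lemma measurable_funpow:
  assumes "f \<in> measurable M M" shows "f ^^ n \<in> measurable M M"
proof (induction n)
  case (Suc n)
  then show ?case unfolding funpow.simps by (rule measurable_comp[OF _ assms])
qed simp

lemma measurable_itinerary:
  assumes "f \<in> measurable M M" "\<phi> \<in> measurable M (count_space S)" "finite S"
  shows "itinerary f \<phi> n \<in> measurable M (count_space (\<Pi>\<^sub>E i\<in>{..<n}. S))"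
  unfolding itinerary_def[abs_def]
  by (rule measurable_finite_word[OF measurable_compose[OF measurable_funpow[OF assms(1)] assms(2)] assms(3)])

text \<open>Fekete's lemma: the limit is the infimum \<open>L\<close> over \<open>n \<ge> 1\<close>.
  Dividing \<open>n\<close> by an \<open>m\<close> that almost attains \<open>L\<close> bounds
  \<open>a n / n\<close> by \<open>a m / m\<close> plus a term of order
  \<open>1 / n\<close>.\<close>

lemma fekete_convergent:
  fixes a :: "nat \<Rightarrow> real"
  assumes nonneg: "\<And>n. 0 \<le> a n" and sub: "\<And>m n. a (m + n) \<le> a m + a n"
  shows "convergent (\<lambda>n. a n / real n)"
proof -
  define L where "L = (INF n\<in>{1..}. a n / real n)"
  have bdd: "bdd_below ((\<lambda>n. a n / real n) ` {1..})"
    using nonneg by (intro bdd_belowI[of _ 0]) auto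
  \<comment> \<open>Subadditivity gives only \<open>a 0 \<ge> 0\<close>, so the case
    \<open>q = 0\<close> calls for the summand \<open>a 0\<close>.\<close>
  have mult: "a (q * m) \<le> real q * a m + a 0" for q m
  proof (induction q)
    case (Suc q)
    show ?case using sub[of m "q * m"] Suc by (simp add: algebra_simps)
  qed simp
  have "(\<lambda>n. a n / real n) \<longlonglongrightarrow> L"
  proof (rule LIMSEQ_I)
    fix e :: real assume "e > 0"
    then have "L < L + e / 2" by simp
    moreover have "{1::nat..} \<noteq> {}" by auto
    ultimately have "\<exists>m\<in>{1..}. a m / real m < L + e / 2"
      using cINF_less_iff[OF _ bdd] unfolding L_def by blast
    then obtain m where m: "m \<ge> 1" "a m / real m < L + e / 2" by auto
    \<comment> \<open>Bounds the remainder of the division together with \<open>a 0\<close>,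
      uniformly in \<open>n\<close>.\<close>
    define C where "C = a 0 + (\<Sum>r<m. a r)"
    have C: "a n \<le> real n * (L + e / 2) + C" for n
    proof -
      have "a n \<le> a (n div m * m) + a (n mod m)"
        using sub[of "n div m * m" "n mod m"] by simp
      also have "a (n mod m) \<le> (\<Sum>r<m. a r)"
        using m nonneg by (intro member_le_sum) auto
      finally have 1: "a n \<le> real (n div m) * a m + C"
        using mult[of "n div m" m] by (simp add: C_def)
      have "real (n div m) * a m = real (n div m * m) * (a m / real m)"
        using m by simp
      also have "\<dots> \<le> real n * (a m / real m)"
        using nonneg[of m] by (intro mult_right_mono) (simp_all add: div_times_less_eq_dividend del: of_nat_mult)
      also have "\<dots> \<le> real n * (L + e / 2)"
        using m by (intro mult_left_mono) auto
      finally show ?thesis using 1 by simp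
    qed
    obtain N :: nat where N: "real N > 2 * \<bar>C\<bar> / e" using reals_Archimedean2 by blast
    have "norm (a n / real n - L) < e" if n: "n \<ge> Suc N" for n
    proof -
      have "L \<le> a n / real n"
        unfolding L_def using n by (intro cINF_lower[OF bdd]) auto
      moreover have "a n / real n \<le> L + e / 2 + C / real n"
        using C[of n] n by (simp add: field_simps)
      moreover have "C / real n < e / 2"
      proof -
        have "2 * \<bar>C\<bar> / e < real n" using N n by linarith
        then have "2 * \<bar>C\<bar> < e * real n" using \<open>e > 0\<close> by (simp add: field_simps)
        then have "C < e / 2 * real n" by linarith
        then show ?thesis using n by (simp add: field_simps)
      qed
      ultimately show ?thesis
        unfolding real_norm_def abs_less_iff using \<open>e > 0\<close> by linarith
    qed
    then show "\<exists>no. \<forall>n\<ge>no. norm (a n / real n - L) < e" by blast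
  qed
  then show ?thesis by (rule convergentI)
qed

section \<open>Entropy inequalities on a probability space\<close>

context prob_space
begin

lemma
  fixes h :: "'b \<Rightarrow> real"
  assumes X: "X \<in> measurable M (count_space S)" and S: "finite S"
  shows integrable_finite_valued: "integrable M (\<lambda>x. h (X x))"
    and expectation_finite_valued:
      "expectation (\<lambda>x. h (X x)) = (\<Sum>a\<in>S. prob (X -` {a} \<inter> space M) * h a)"
proof -
  have eq: "h (X x) = (\<Sum>a\<in>S. h a * indicator (X -` {a} \<inter> space M) x)" if "x \<in> space M" for x
  proof -
    have "X x \<in> S" using measurable_space[OF X that] by simp
    then have "h (X x) = (\<Sum>a\<in>S. if a = X x then h a else 0)" using S by simp
    also have "\<dots> = (\<Sum>a\<in>S. h a * indicator (X -` {a} \<inter> space M) x)"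
      using that by (intro sum.cong) (auto simp: indicator_def)
    finally show ?thesis .
  qed
  have [measurable]: "X -` {a} \<inter> space M \<in> events" if "a \<in> S" for a
    using X that by (intro measurable_sets[OF X]) auto
  have int: "integrable M (\<lambda>x. h a * indicator (X -` {a} \<inter> space M) x)" if "a \<in> S" for a
    using that by (intro integrable_mult_right integrable_real_indicator) (auto simp: emeasure_eq_measure)
  show "integrable M (\<lambda>x. h (X x))"
    using int by (subst Bochner_Integration.integrable_cong[OF refl eq]) auto
  have "expectation (\<lambda>x. h (X x)) = expectation (\<lambda>x. \<Sum>a\<in>S. h a * indicator (X -` {a} \<inter> space M) x)"
    by (intro Bochner_Integration.integral_cong refl eq)
  also have "\<dots> = (\<Sum>a\<in>S. expectation (\<lambda>x. h a * indicator (X -` {a} \<inter> space M) x))"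
    using int by (intro Bochner_Integration.integral_sum) auto
  also have "\<dots> = (\<Sum>a\<in>S. prob (X -` {a} \<inter> space M) * h a)"
    by (intro sum.cong refl) simp
  finally show "expectation (\<lambda>x. h (X x)) = (\<Sum>a\<in>S. prob (X -` {a} \<inter> space M) * h a)" .
qed

text \<open>Shannon entropy in bits, as mean information content. Written as an expectation it
  mentions no alphabet and compares directly with the mean of other code lengths.\<close>

definition value_entropy :: "('a \<Rightarrow> 'b) \<Rightarrow> real" where
  "value_entropy X = expectation (\<lambda>x. - log 2 (prob (X -` {X x} \<inter> space M)))"

lemma value_entropy_sum:
  assumes "X \<in> measurable M (count_space S)" "finite S"
  shows "value_entropy X =
    - (\<Sum>a\<in>S. prob (X -` {a} \<inter> space M) * log 2 (prob (X -` {a} \<inter> space M)))"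
  unfolding value_entropy_def
  using expectation_finite_valued[OF assms, of "\<lambda>a. - log 2 (prob (X -` {a} \<inter> space M))"]
  by (simp add: sum_negf)

lemma sum_prob_finite_valued:
  assumes "X \<in> measurable M (count_space S)" "finite S"
  shows "(\<Sum>a\<in>S. prob (X -` {a} \<inter> space M)) = 1"
  using expectation_finite_valued[OF assms, of "\<lambda>_. 1"] by (simp add: prob_space)

lemma value_entropy_nonneg:
  assumes "X \<in> measurable M (count_space S)" "finite S"
  shows "value_entropy X \<ge> 0"
  unfolding value_entropy_def
proof (rule Bochner_Integration.integral_nonneg)
  fix x
  define p where "p = prob (X -` {X x} \<inter> space M)"
  have "ln p \<le> 0"
  \<comment> \<open>\<open>ln 0 = 0\<close>, so fibres of probability zero do no harm.\<close>
  proof (cases "p = 0")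
    case False
    then have "0 < p" by (simp add: p_def zero_less_measure_iff)
    then show ?thesis using ln_le_minus_one[of p] prob_le_1[of "X -` {X x} \<inter> space M"]
      unfolding p_def by linarith
  qed simp
  then show "0 \<le> - log 2 (prob (X -` {X x} \<inter> space M))"
    by (simp add: log_def p_def divide_nonpos_pos)
qed

text \<open>Gibbs' inequality, from \<open>ln y \<le> y - 1\<close> at \<open>y = w a / p a\<close>.
  A weight vanishing at a value of positive probability would be read as \<open>log 2 0 = 0\<close>;
  \<open>pos\<close> excludes this.\<close>

lemma value_entropy_le_cross_entropy:
  assumes X: "X \<in> measurable M (count_space S)" and S: "finite S"
    and w: "\<And>a. a \<in> S \<Longrightarrow> 0 \<le> w a"
    and pos: "\<And>a. a \<in> S \<Longrightarrow> prob (X -` {a} \<inter> space M) > 0 \<Longrightarrow> w a > 0"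
    and sum: "(\<Sum>a\<in>S. w a) \<le> 1"
  shows "value_entropy X \<le> expectation (\<lambda>x. - log 2 (w (X x)))"
proof -
  define p where "p a = prob (X -` {a} \<inter> space M)" for a
  have "p a * - log 2 (p a) - p a * - log 2 (w a) \<le> (w a - p a) / ln 2" if "a \<in> S" for a
  proof (cases "p a > 0")
    case True
    then have "w a > 0" using pos that by (simp add: p_def)
    then have "p a * ln (w a / p a) \<le> p a * (w a / p a - 1)"
      using True by (intro mult_left_mono ln_le_minus_one) auto
    also have "\<dots> = w a - p a" using True by (simp add: field_simps)
    finally have "p a * ln (w a / p a) / ln 2 \<le> (w a - p a) / ln 2"
      by (intro divide_right_mono) auto
    moreover have "p a * ln (w a / p a) / ln 2 = p a * - log 2 (p a) - p a * - log 2 (w a)"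
      using True \<open>w a > 0\<close> by (simp add: log_def ln_div field_simps)
    ultimately show ?thesis by simp
  next
    case False
    then have "p a = 0" using measure_nonneg[of M "X -` {a} \<inter> space M"] by (simp add: p_def)
    then show ?thesis using w[OF that] by simp
  qed
  then have "(\<Sum>a\<in>S. p a * - log 2 (p a)) - (\<Sum>a\<in>S. p a * - log 2 (w a)) \<le> (\<Sum>a\<in>S. (w a - p a) / ln 2)"
    unfolding sum_subtractf[symmetric] by (rule sum_mono)
  also have "\<dots> = ((\<Sum>a\<in>S. w a) - 1) / ln 2"
    using sum_prob_finite_valued[OF X S] by (simp add: sum_divide_distrib[symmetric] sum_subtractf p_def)
  also have "\<dots> \<le> 0" using sum by (simp add: divide_nonpos_pos)
  finally show ?thesis
    using expectation_finite_valued[OF X S, of "\<lambda>a. - log 2 (w a)"] value_entropy_sum[OF X S]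
    by (simp add: p_def sum_negf)
qed

text \<open>Gibbs' inequality with the product of the laws of \<open>u (Z x)\<close> and
  \<open>v (Z x)\<close> as reference weight. By \<open>inj\<close> its sum over \<open>U\<close> is
  part of the sum over \<open>S \<times> T\<close>, which is 1.\<close>

lemma value_entropy_subadditive:
  assumes Z: "Z \<in> measurable M (count_space U)" and U: "finite U"
    and S: "finite S" "u \<in> U \<rightarrow> S" and T: "finite T" "v \<in> U \<rightarrow> T"
    and inj: "inj_on (\<lambda>z. (u z, v z)) U"
  shows "value_entropy Z \<le> value_entropy (\<lambda>x. u (Z x)) + value_entropy (\<lambda>x. v (Z x))"
proof -
  have mu: "(\<lambda>x. u (Z x)) \<in> measurable M (count_space S)"
    and mv: "(\<lambda>x. v (Z x)) \<in> measurable M (count_space T)"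
    using S T by (auto intro!: measurable_compose[OF Z])
  define p where "p a = prob ((\<lambda>x. u (Z x)) -` {a} \<inter> space M)" for a
  define q where "q b = prob ((\<lambda>x. v (Z x)) -` {b} \<inter> space M)" for b
  have ev: "Z -` {z} \<inter> space M \<in> events" "(\<lambda>x. u (Z x)) -` {u z} \<inter> space M \<in> events"
      "(\<lambda>x. v (Z x)) -` {v z} \<inter> space M \<in> events" if "z \<in> U" for z
    using that S T by (auto intro!: measurable_sets[OF Z] measurable_sets[OF mu] measurable_sets[OF mv])
  have pz: "prob (Z -` {z} \<inter> space M) \<le> p (u z)" "prob (Z -` {z} \<inter> space M) \<le> q (v z)" if "z \<in> U" for z
    unfolding p_def q_def using ev[OF that] by (auto intro!: finite_measure_mono)
  have nn: "p a \<ge> 0" "q b \<ge> 0" for a b by (auto simp: p_def q_def)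
  have "(\<Sum>z\<in>U. p (u z) * q (v z)) = (\<Sum>(a, b)\<in>(\<lambda>z. (u z, v z)) ` U. p a * q b)"
    using inj by (subst sum.reindex) auto
  also have "\<dots> \<le> (\<Sum>(a, b)\<in>S \<times> T. p a * q b)"
    using S T nn by (intro sum_mono2) auto
  also have "\<dots> = (\<Sum>a\<in>S. p a) * (\<Sum>b\<in>T. q b)"
    by (simp add: sum_product sum.cartesian_product)
  also have "\<dots> = 1"
    using sum_prob_finite_valued[OF mu S(1)] sum_prob_finite_valued[OF mv T(1)] by (simp add: p_def q_def)
  finally have "value_entropy Z \<le> expectation (\<lambda>x. - log 2 (p (u (Z x)) * q (v (Z x))))"
    using pz nn by (intro value_entropy_le_cross_entropy[OF Z U]) (auto intro!: mult_pos_pos intro: less_le_trans)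
  also have "\<dots> = (\<Sum>z\<in>U. prob (Z -` {z} \<inter> space M) * - log 2 (p (u z) * q (v z)))"
    by (rule expectation_finite_valued[OF Z U])
  also have "\<dots> = (\<Sum>z\<in>U. prob (Z -` {z} \<inter> space M) * (- log 2 (p (u z)) + - log 2 (q (v z))))"
  \<comment> \<open>On a fibre of positive probability both marginals are positive and the logarithm
    splits; on a null fibre both sides carry the factor 0.\<close>
  proof (intro sum.cong refl)
    fix z assume z: "z \<in> U"
    show "prob (Z -` {z} \<inter> space M) * - log 2 (p (u z) * q (v z)) =
        prob (Z -` {z} \<inter> space M) * (- log 2 (p (u z)) + - log 2 (q (v z)))"
    proof (cases "prob (Z -` {z} \<inter> space M) = 0")
      case False
      then have "prob (Z -` {z} \<inter> space M) > 0" by (simp add: zero_less_measure_iff)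
      then have "p (u z) > 0" "q (v z) > 0" using pz[OF z] by linarith+
      then show ?thesis by (simp add: log_mult)
    qed simp
  qed
  also have "\<dots> = expectation (\<lambda>x. - log 2 (p (u (Z x))) + - log 2 (q (v (Z x))))"
    by (rule expectation_finite_valued[OF Z U, symmetric])
  also have "\<dots> = expectation (\<lambda>x. - log 2 (p (u (Z x)))) + expectation (\<lambda>x. - log 2 (q (v (Z x))))"
    using integrable_finite_valued[OF Z U, of "\<lambda>z. - log 2 (p (u z))"]
      integrable_finite_valued[OF Z U, of "\<lambda>z. - log 2 (q (v z))"]
    by (rule Bochner_Integration.integral_add)
  finally show ?thesis by (simp add: value_entropy_def p_def q_def)
qed

text \<open>The reference weight of a word is the average over the codewords \<open>b \<in> G\<close> of the probability
  that \<open>b\<close>, sent through the memoryless channel which replaces each letter with probability \<open>\<theta>\<close>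
  by a uniformly random one, is received as that word.\<close>

lemma value_entropy_le_codewords:
  fixes X Y :: "nat \<Rightarrow> 'a \<Rightarrow> 'b"
  assumes X: "\<And>i. i < n \<Longrightarrow> X i \<in> measurable M (count_space S)" and S: "finite S" "S \<noteq> {}"
    and G: "finite G" "\<And>x. x \<in> space M \<Longrightarrow> (\<lambda>i\<in>{..<n}. Y i x) \<in> G"
    and E: "\<And>i. i < n \<Longrightarrow> E i \<in> events" "\<And>i. i < n \<Longrightarrow> prob (E i) \<le> e"
      "\<And>i x. i < n \<Longrightarrow> x \<in> space M \<Longrightarrow> X i x \<noteq> Y i x \<Longrightarrow> x \<in> E i"
    and \<theta>: "0 < \<theta>" "\<theta> < 1"
  shows "value_entropy (\<lambda>x. \<lambda>i\<in>{..<n}. X i x) \<le>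
    log 2 (real (card G)) + real n * (- log 2 (1 - \<theta>) + e * log 2 (real (card S) / \<theta>))"
proof -
  define r where "r = real (card S)"
  have r: "r \<ge> 1" using S by (simp add: r_def Suc_le_eq card_gt_0_iff)
  \<comment> \<open>The cost in bits of a wrong letter, whose weight is
    \<open>\<theta> / r\<close>.\<close>
  define K where "K = log 2 (r / \<theta>)"
  have K: "K \<ge> 0" using r \<theta> by (simp add: K_def)
  define W where "W b a = (1 - \<theta>) * of_bool (a = b) + \<theta> / r" for a b :: 'b
  have W: "W b a > 0" for a b
    using \<theta> r by (auto simp: W_def intro: add_nonneg_pos)
  define w where "w a = (\<Sum>b\<in>G. \<Prod>i<n. W (b i) (a i)) / real (card G)" for a
  define Z where "Z x = (\<lambda>i\<in>{..<n}. X i x)" for x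
  have Z: "Z \<in> measurable M (count_space (\<Pi>\<^sub>E i\<in>{..<n}. S))"
    unfolding Z_def using X S by (intro measurable_finite_word) auto
  have fin: "finite (\<Pi>\<^sub>E i\<in>{..<n}. S)" using S by (intro finite_PiE) auto
  have "G \<noteq> {}" using G(2) not_empty by blast
  then have card: "real (card G) > 0" using G by (simp add: card_gt_0_iff)
  have wpos: "w a > 0" for a
    unfolding w_def using card G \<open>G \<noteq> {}\<close> W by (intro divide_pos_pos sum_pos prod_pos) auto
  \<comment> \<open>Equality can fail: for a codeword letter outside \<open>S\<close> only the
    uniform part, of total weight \<open>\<theta>\<close>, remains.\<close>
  have Wsum: "(\<Sum>a\<in>S. W b a) \<le> 1" for b
  proof -
    have "(\<Sum>a\<in>S. W b a) = (1 - \<theta>) * (\<Sum>a\<in>S. of_bool (a = b)) + \<theta>"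
      using r by (simp add: W_def sum.distrib sum_distrib_left r_def)
    also have "(\<Sum>a\<in>S. of_bool (a = b) :: real) \<le> 1"
      using S by (simp add: of_bool_def)
    finally show ?thesis using \<theta> by simp
  qed
  have "(\<Sum>a\<in>(\<Pi>\<^sub>E i\<in>{..<n}. S). w a)
      = (\<Sum>b\<in>G. \<Sum>a\<in>(\<Pi>\<^sub>E i\<in>{..<n}. S). \<Prod>i<n. W (b i) (a i)) / real (card G)"
    unfolding w_def sum_divide_distrib[symmetric] by (subst sum.swap) simp
  \<comment> \<open>The channel is memoryless, so the sum over words factorises into sums over
    letters.\<close>
  also have "\<dots> = (\<Sum>b\<in>G. \<Prod>i<n. \<Sum>a\<in>S. W (b i) a) / real (card G)"
    using S by (subst prod_sum_PiE) auto
  also have "\<dots> \<le> (\<Sum>b\<in>G. 1) / real (card G)"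
    using Wsum by (intro divide_right_mono sum_mono prod_le_1) (auto intro!: sum_nonneg less_imp_le[OF W])
  also have "\<dots> = 1" using card by simp
  finally have wsum: "(\<Sum>a\<in>(\<Pi>\<^sub>E i\<in>{..<n}. S). w a) \<le> 1" .
  have pt: "- log 2 (w (Z x)) \<le> log 2 (real (card G)) + (\<Sum>i<n. - log 2 (1 - \<theta>) + indicator (E i) x * K)"
    if x: "x \<in> space M" for x
  proof -
    define b where "b = (\<lambda>i\<in>{..<n}. Y i x)"
    have P: "(\<Prod>i<n. W (Y i x) (X i x)) > 0" using W by (intro prod_pos) auto
    have "(\<Prod>i<n. W (Y i x) (X i x)) = (\<Prod>i<n. W (b i) (Z x i))"
      by (intro prod.cong) (auto simp: b_def Z_def)
    \<comment> \<open>Of the mixture only the codeword belonging to \<open>x\<close> matters; the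
      others are bounded below by zero, at the price of \<open>log 2 (card G)\<close> bits.\<close>
    also have "\<dots> \<le> (\<Sum>b\<in>G. \<Prod>i<n. W (b i) (Z x i))"
    proof (rule member_le_sum[where f = "\<lambda>b. \<Prod>i<n. W (b i) (Z x i)"])
      show "b \<in> G" unfolding b_def by (rule G(2)[OF x])
      show "0 \<le> (\<Prod>i<n. W (b i) (Z x i))" for b
        by (intro prod_nonneg less_imp_le[OF W] ballI)
    qed (rule G(1))
    finally have "(\<Prod>i<n. W (Y i x) (X i x)) / real (card G) \<le> w (Z x)"
      using card by (simp add: w_def divide_right_mono)
    then have "log 2 ((\<Prod>i<n. W (Y i x) (X i x)) / real (card G)) \<le> log 2 (w (Z x))"
      using P card wpos by simp
    moreover have "log 2 ((\<Prod>i<n. W (Y i x) (X i x)) / real (card G))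
        = log 2 (\<Prod>i<n. W (Y i x) (X i x)) - log 2 (real (card G))"
      by (rule log_divide_pos[OF P card])
    moreover have "log 2 (\<Prod>i<n. W (Y i x) (X i x)) = (\<Sum>i<n. log 2 (W (Y i x) (X i x)))"
      unfolding log_def sum_divide_distrib[symmetric]
      by (intro arg_cong[where f = "\<lambda>y. y / ln 2"] ln_prod finite_lessThan less_imp_neq[OF W, symmetric])
    \<comment> \<open>The bound charges \<open>K\<close> on all of \<open>E i\<close>, which
      contains the mismatches at position \<open>i\<close>.\<close>
    moreover have "(\<Sum>i<n. - log 2 (W (Y i x) (X i x)))
        \<le> (\<Sum>i<n. - log 2 (1 - \<theta>) + indicator (E i) x * K)"
    proof (rule sum_mono)
      fix i assume "i \<in> {..<n}"
      then have i: "i < n" by simp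
      show "- log 2 (W (Y i x) (X i x)) \<le> - log 2 (1 - \<theta>) + indicator (E i) x * K"
      proof (cases "X i x = Y i x")
        case True
        have "1 - \<theta> \<le> W (Y i x) (X i x)" using True r \<theta> by (simp add: W_def)
        then have "log 2 (1 - \<theta>) \<le> log 2 (W (Y i x) (X i x))" using \<theta> W by simp
        moreover have "0 \<le> indicator (E i) x * K" using K by simp
        ultimately show ?thesis by linarith
      next
        case False
        then have "x \<in> E i" using E(3) i x by blast
        have "log 2 (W (Y i x) (X i x)) = log 2 (\<theta> / r)" using False by (simp add: W_def)
        also have "\<dots> = - K" using r \<theta> by (simp add: K_def log_divide)
        finally have "- log 2 (W (Y i x) (X i x)) = K" by simp
        moreover have "log 2 (1 - \<theta>) \<le> 0" using \<theta> by simp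
        ultimately show ?thesis using \<open>x \<in> E i\<close> by simp
      qed
    qed
    ultimately show ?thesis by (simp add: sum_negf)
  qed
  have intE: "integrable M (\<lambda>x. indicator (E i) x * K)" if "i < n" for i
    using E(1)[OF that] by (intro integrable_mult_left integrable_real_indicator) (auto simp: emeasure_eq_measure)
  have intS: "integrable M (\<lambda>x. \<Sum>i<n. - log 2 (1 - \<theta>) + indicator (E i) x * K)"
    by (rule Bochner_Integration.integrable_sum, rule Bochner_Integration.integrable_add[OF integrable_const intE]) simp
  have "value_entropy Z \<le> expectation (\<lambda>x. - log 2 (w (Z x)))"
    using wpos wsum by (intro value_entropy_le_cross_entropy[OF Z fin]) (auto intro: less_imp_le)
  also have "\<dots> \<le> expectation (\<lambda>x. log 2 (real (card G)) + (\<Sum>i<n. - log 2 (1 - \<theta>) + indicator (E i) x * K))"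
  proof (rule integral_mono)
    show "integrable M (\<lambda>x. - log 2 (w (Z x)))"
      by (rule integrable_finite_valued[OF Z fin])
    show "integrable M (\<lambda>x. log 2 (real (card G)) + (\<Sum>i<n. - log 2 (1 - \<theta>) + indicator (E i) x * K))"
      by (rule Bochner_Integration.integrable_add[OF integrable_const intS])
  qed (rule pt)
  also have "\<dots> = log 2 (real (card G)) + (\<Sum>i<n. - log 2 (1 - \<theta>) + prob (E i) * K)"
  proof -
    have "expectation (\<lambda>x. log 2 (real (card G)) + (\<Sum>i<n. - log 2 (1 - \<theta>) + indicator (E i) x * K))
        = log 2 (real (card G)) + expectation (\<lambda>x. \<Sum>i<n. - log 2 (1 - \<theta>) + indicator (E i) x * K)"
      by (subst Bochner_Integration.integral_add[OF integrable_const intS]) (simp add: prob_space)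
    also have "expectation (\<lambda>x. \<Sum>i<n. - log 2 (1 - \<theta>) + indicator (E i) x * K)
        = (\<Sum>i<n. expectation (\<lambda>x. - log 2 (1 - \<theta>) + indicator (E i) x * K))"
      using intE by (intro Bochner_Integration.integral_sum Bochner_Integration.integrable_add) auto
    also have "\<dots> = (\<Sum>i<n. - log 2 (1 - \<theta>) + prob (E i) * K)"
    proof (rule sum.cong[OF refl])
      fix i assume "i \<in> {..<n}"
      then have i: "i < n" by simp
      have "expectation (\<lambda>x. - log 2 (1 - \<theta>) + indicator (E i) x * K)
          = expectation (\<lambda>x. - log 2 (1 - \<theta>)) + expectation (\<lambda>x. indicator (E i) x * K)"
        using intE[OF i] by (intro Bochner_Integration.integral_add) auto
      also have "\<dots> = - log 2 (1 - \<theta>) + prob (E i) * K"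
        using E(1)[OF i] sets.sets_into_space[OF E(1)[OF i]] by (simp add: prob_space Int_absorb1)
      finally show "expectation (\<lambda>x. - log 2 (1 - \<theta>) + indicator (E i) x * K)
          = - log 2 (1 - \<theta>) + prob (E i) * K" .
    qed
    finally show ?thesis .
  qed
  also have "\<dots> \<le> log 2 (real (card G)) + (\<Sum>i<n. - log 2 (1 - \<theta>) + e * K)"
    using E(2) K by (intro add_left_mono sum_mono mult_right_mono) auto
  finally show ?thesis by (simp add: Z_def[abs_def] K_def r_def)
qed

section \<open>Invariance and the entropy rate\<close>

text \<open>By invariance the two maps have the same law. This serves twice: to cut a long itinerary
  in two, and to start itineraries only when the estimates have become good.\<close>

lemma value_entropy_funpow:
  assumes f: "f \<in> measurable M M" "distr M M f = M" and X: "X \<in> measurable M (count_space S)" "finite S"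
  shows "value_entropy (\<lambda>x. X ((f ^^ n) x)) = value_entropy X"
proof (induction n)
  case (Suc n)
  have mX: "(\<lambda>x. X ((f ^^ n) x)) \<in> measurable M (count_space S)"
    by (rule measurable_compose[OF measurable_funpow[OF f(1)] X(1)])
  have mXf: "(\<lambda>x. X ((f ^^ n) (f x))) \<in> measurable M (count_space S)"
    using measurable_compose[OF f(1) mX] by simp
  have "prob ((\<lambda>x. X ((f ^^ n) (f x))) -` {a} \<inter> space M) = prob ((\<lambda>x. X ((f ^^ n) x)) -` {a} \<inter> space M)"
    if "a \<in> S" for a
  proof -
    have "(\<lambda>x. X ((f ^^ n) x)) -` {a} \<inter> space M \<in> events"
      using that by (intro measurable_sets[OF mX]) auto
    then have "measure (distr M M f) ((\<lambda>x. X ((f ^^ n) x)) -` {a} \<inter> space M)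
        = prob (f -` ((\<lambda>x. X ((f ^^ n) x)) -` {a} \<inter> space M) \<inter> space M)"
      by (intro measure_distr f)
    also have "f -` ((\<lambda>x. X ((f ^^ n) x)) -` {a} \<inter> space M) \<inter> space M
        = (\<lambda>x. X ((f ^^ n) (f x))) -` {a} \<inter> space M"
      using measurable_space[OF f(1)] by auto
    finally show ?thesis using f by simp
  qed
  then have "value_entropy (\<lambda>x. X ((f ^^ n) (f x))) = value_entropy (\<lambda>x. X ((f ^^ n) x))"
    unfolding value_entropy_sum[OF mX X(2)] value_entropy_sum[OF mXf X(2)]
    by (intro arg_cong[where f = uminus] sum.cong) simp_all
  then show ?case using Suc by (simp add: funpow_swap1)
qed simp

text \<open>Entropy along a partition is defined by \<open>lim\<close>, which is informative only
  under convergence. A word of length \<open>m + n\<close> splits into its first \<open>m\<close>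
  letters and the rest; the rest is distributed like an itinerary of length \<open>n\<close>, so
  Fekete's lemma applies.\<close>

lemma convergent_value_entropy_itinerary:
  assumes f: "f \<in> measurable M M" "distr M M f = M" and \<phi>: "\<phi> \<in> measurable M (count_space S)" "finite S"
  shows "convergent (\<lambda>n. value_entropy (itinerary f \<phi> n) / real n)"
proof (rule fekete_convergent)
  note it = measurable_itinerary[OF f(1) \<phi>]
  have fin: "finite (\<Pi>\<^sub>E i\<in>{..<n}. S)" for n :: nat using \<phi>(2) by (intro finite_PiE) auto
  show "0 \<le> value_entropy (itinerary f \<phi> n)" for n
    by (rule value_entropy_nonneg[OF it fin])
  fix m n :: nat
  let ?u = "\<lambda>z. restrict z {..<m}" and ?v = "\<lambda>z. \<lambda>i\<in>{..<n}. z (m + i)"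
  have inj: "inj_on (\<lambda>z. (?u z, ?v z)) (\<Pi>\<^sub>E i\<in>{..<m + n}. S)"
  proof (rule inj_onI)
    fix z z' assume z: "z \<in> (\<Pi>\<^sub>E i\<in>{..<m + n}. S)" "z' \<in> (\<Pi>\<^sub>E i\<in>{..<m + n}. S)"
      and eq: "(?u z, ?v z) = (?u z', ?v z')"
    have eu: "?u z = ?u z'" using eq by (rule Pair_inject)
    have ev: "?v z = ?v z'" using eq by (rule Pair_inject)
    show "z = z'"
    proof (rule PiE_ext[OF z])
      fix i assume i: "i \<in> {..<m + n}"
      show "z i = z' i"
      proof (cases "i < m")
        case True
        then show ?thesis using fun_cong[OF eu, of i] by simp
      next
        case False
        then have "m + (i - m) = i" "i - m \<in> {..<n}" using i by auto
        then show ?thesis using fun_cong[OF ev, of "i - m"] by simp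
      qed
    qed
  qed
  have u: "?u \<in> (\<Pi>\<^sub>E i\<in>{..<m + n}. S) \<rightarrow> (\<Pi>\<^sub>E i\<in>{..<m}. S)"
  proof
    fix z assume z: "z \<in> (\<Pi>\<^sub>E i\<in>{..<m + n}. S)"
    show "?u z \<in> (\<Pi>\<^sub>E i\<in>{..<m}. S)"
      unfolding restrict_PiE_iff using PiE_mem[OF z] by simp
  qed
  have v: "?v \<in> (\<Pi>\<^sub>E i\<in>{..<m + n}. S) \<rightarrow> (\<Pi>\<^sub>E i\<in>{..<n}. S)"
  proof
    fix z assume z: "z \<in> (\<Pi>\<^sub>E i\<in>{..<m + n}. S)"
    show "?v z \<in> (\<Pi>\<^sub>E i\<in>{..<n}. S)"
      unfolding restrict_PiE_iff using PiE_mem[OF z] by simp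
  qed
  have le: "value_entropy (itinerary f \<phi> (m + n)) \<le>
      value_entropy (\<lambda>x. ?u (itinerary f \<phi> (m + n) x)) + value_entropy (\<lambda>x. ?v (itinerary f \<phi> (m + n) x))"
    by (rule value_entropy_subadditive[OF it[of "m + n"] fin[of "m + n"] fin[of m] u fin[of n] v inj])
  have u_eq: "(\<lambda>x. ?u (itinerary f \<phi> (m + n) x)) = itinerary f \<phi> m"
    by (intro ext) (simp add: itinerary_def restrict_def)
  have v_eq: "(\<lambda>x. ?v (itinerary f \<phi> (m + n) x)) = (\<lambda>x. itinerary f \<phi> n ((f ^^ m) x))"
  proof (intro ext)
    fix x i
    have "(f ^^ (m + i)) x = (f ^^ i) ((f ^^ m) x)"
      by (simp add: add.commute funpow_add)
    then show "?v (itinerary f \<phi> (m + n) x) i = itinerary f \<phi> n ((f ^^ m) x) i"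
      by (simp add: itinerary_def)
  qed
  have shift: "value_entropy (\<lambda>x. itinerary f \<phi> n ((f ^^ m) x)) = value_entropy (itinerary f \<phi> n)"
    by (rule value_entropy_funpow[OF f it[of n] fin[of n], where n = m])
  show "value_entropy (itinerary f \<phi> (m + n))
      \<le> value_entropy (itinerary f \<phi> m) + value_entropy (itinerary f \<phi> n)"
    using le unfolding u_eq v_eq shift .
qed

end

section \<open>Partitions and their cells\<close>

definition cell :: "'a set set \<Rightarrow> 'a \<Rightarrow> 'a set" where
  "cell P x = (THE A. A \<in> P \<and> x \<in> A)"

lemma cell_eqI:
  assumes P: "partition_on UNIV P" and A: "A \<in> P" "x \<in> A"
  shows "cell P x = A"
  unfolding cell_def
proof (rule the_equality)
  fix B assume "B \<in> P \<and> x \<in> B"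
  then show "B = A" using partition_onD2[OF P] A by (auto simp: disjoint_def)
qed (use A in simp)

lemma
  assumes P: "partition_on UNIV P"
  shows cell_in: "cell P x \<in> P" and in_cell: "x \<in> cell P x"
proof -
  obtain A where "A \<in> P" "x \<in> A" using partition_onD1[OF P] by blast
  with cell_eqI[OF P this] show "cell P x \<in> P" "x \<in> cell P x" by simp_all
qed

lemma cell_eq_iff:
  assumes "partition_on UNIV P" "A \<in> P"
  shows "cell P x = A \<longleftrightarrow> x \<in> A"
  using cell_eqI[OF assms] in_cell[OF assms(1), of x] by auto

text \<open>Words index the cells by time, whereas \<open>common_refinement\<close> chooses from a
  set of partitions, where equal pullbacks at different times are merged. Words that choose
  differently from equal pullbacks have empty intersection.\<close>

lemma partition_join_eq:
  assumes P: "partition_on UNIV P"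
  shows "partition_join f P n = (\<lambda>a. {x. \<forall>i<n. (f ^^ i) x \<in> a i}) ` (\<Pi>\<^sub>E i\<in>{..<n}. P) - {{}}"
proof (intro equalityI subsetI)
  fix C assume "C \<in> partition_join f P n"
  then obtain c where "C \<noteq> {}" and C: "C = \<Inter> (c ` (\<lambda>i. pullback_partition f i P) ` {..<n})"
    and c: "c \<in> (\<Pi> R\<in>(\<lambda>i. pullback_partition f i P) ` {..<n}. R)"
    unfolding partition_join_def common_refinement by blast
  have "\<exists>A\<in>P. c (pullback_partition f i P) = (f ^^ i) -` A" if "i < n" for i
  proof -
    have "c (pullback_partition f i P) \<in> pullback_partition f i P"
      using that by (intro Pi_mem[OF c]) auto
    then show ?thesis by (auto simp: pullback_partition_def)
  qed
  then obtain a where a: "\<And>i. i < n \<Longrightarrow> a i \<in> P"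
    "\<And>i. i < n \<Longrightarrow> c (pullback_partition f i P) = (f ^^ i) -` a i" by metis
  have "restrict a {..<n} \<in> (\<Pi>\<^sub>E i\<in>{..<n}. P)" using a(1) by simp
  moreover have "C = {x. \<forall>i<n. (f ^^ i) x \<in> restrict a {..<n} i}"
    unfolding C using a(2) by auto
  ultimately show "C \<in> (\<lambda>a. {x. \<forall>i<n. (f ^^ i) x \<in> a i}) ` (\<Pi>\<^sub>E i\<in>{..<n}. P) - {{}}"
    using \<open>C \<noteq> {}\<close> by blast
next
  fix C assume "C \<in> (\<lambda>a. {x. \<forall>i<n. (f ^^ i) x \<in> a i}) ` (\<Pi>\<^sub>E i\<in>{..<n}. P) - {{}}"
  then obtain a where C: "C = {x. \<forall>i<n. (f ^^ i) x \<in> a i}" "C \<noteq> {}"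
    and a: "a \<in> (\<Pi>\<^sub>E i\<in>{..<n}. P)" by blast
  then obtain x where x: "\<And>i. i < n \<Longrightarrow> (f ^^ i) x \<in> a i" by blast
  define c where "c R = (SOME B. B \<in> R \<and> x \<in> B)" for R :: "'a set set"
  have c: "c (pullback_partition f i P) = (f ^^ i) -` a i" if "i < n" for i
    unfolding c_def
  proof (rule some_equality)
    have ai: "a i \<in> P" using PiE_mem[OF a, of i] that by simp
    then show "(f ^^ i) -` a i \<in> pullback_partition f i P \<and> x \<in> (f ^^ i) -` a i"
      using x[OF that] by (simp add: pullback_partition_def)
    fix B assume "B \<in> pullback_partition f i P \<and> x \<in> B"
    then obtain A where "A \<in> P" "B = (f ^^ i) -` A" "(f ^^ i) x \<in> A"
      by (auto simp: pullback_partition_def)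
    then show "B = (f ^^ i) -` a i"
      using cell_eqI[OF P] ai x[OF that] by metis
  qed
  have "c \<in> (\<Pi> R\<in>(\<lambda>i. pullback_partition f i P) ` {..<n}. R)"
  proof
    fix R assume "R \<in> (\<lambda>i. pullback_partition f i P) ` {..<n}"
    then obtain i where i: "i < n" "R = pullback_partition f i P" by auto
    then show "c R \<in> R" using c[of i] PiE_mem[OF a, of i] by (auto simp: pullback_partition_def)
  qed
  moreover have "C = \<Inter> (c ` (\<lambda>i. pullback_partition f i P) ` {..<n})"
    unfolding C using c by auto
  ultimately show "C \<in> partition_join f P n"
    using \<open>C \<noteq> {}\<close> unfolding partition_join_def common_refinement by blast
qed

lemma measurable_cell:
  assumes "finite_measurable_partition M P" "space M = UNIV"
  shows "cell P \<in> measurable M (count_space P)"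
proof -
  have P: "partition_on UNIV P" "finite P" "P \<subseteq> sets M"
    using assms by (auto simp: finite_measurable_partition_def)
  have "cell P -` {A} \<inter> space M \<in> sets M" if "A \<in> P" for A
  proof -
    have "cell P -` {A} \<inter> space M = A"
      using cell_eq_iff[OF P(1) that] assms(2) by auto
    then show ?thesis using P that by auto
  qed
  then show ?thesis
    using P cell_in[OF P(1)] by (subst measurable_count_space_eq2) auto
qed

text \<open>The nonempty fibres of the itinerary map are the cells of the join, each coming from a
  single word.\<close>

lemma (in prob_space) partition_entropy_join:
  assumes P: "finite_measurable_partition M P" and sp: "space M = UNIV" and f: "f \<in> measurable M M"
  shows "partition_entropy M (partition_join f P n) = value_entropy (itinerary f (cell P) n)"
proof -
  have P': "partition_on UNIV P" "finite P"
    using P sp by (auto simp: finite_measurable_partition_def)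
  define Q where "Q a = {x. \<forall>i<n. (f ^^ i) x \<in> a i}" for a :: "nat \<Rightarrow> 'a set"
  let ?W = "\<Pi>\<^sub>E i\<in>{..<n}. P"
  have Q: "itinerary f (cell P) n -` {a} \<inter> space M = Q a" if a: "a \<in> ?W" for a
  proof -
    have "itinerary f (cell P) n x = a \<longleftrightarrow> x \<in> Q a" for x
    proof -
      have it: "itinerary f (cell P) n x \<in> ?W"
        by (simp add: itinerary_def cell_in[OF P'(1)])
      have "itinerary f (cell P) n x = a \<longleftrightarrow> (\<forall>i<n. itinerary f (cell P) n x i = a i)"
        using PiE_ext[OF it a] by auto
      also have "\<dots> \<longleftrightarrow> (\<forall>i<n. (f ^^ i) x \<in> a i)"
        using PiE_mem[OF a] by (simp add: itinerary_def cell_eq_iff[OF P'(1)])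
      finally show ?thesis by (simp add: Q_def)
    qed
    then show ?thesis using sp by auto
  qed
  have fin: "finite ?W" using P'(2) by (intro finite_PiE) auto
  have inj: "inj_on Q {a \<in> ?W. Q a \<noteq> {}}"
  proof (rule inj_onI)
    fix a b assume ab: "a \<in> {a \<in> ?W. Q a \<noteq> {}}" "b \<in> {a \<in> ?W. Q a \<noteq> {}}" "Q a = Q b"
    then obtain x where "x \<in> Q a" by blast
    moreover from this have "x \<in> Q b" using ab(3) by simp
    ultimately have "itinerary f (cell P) n x = a" "itinerary f (cell P) n x = b"
      using ab(1,2) by (simp_all add: Q[symmetric])
    then show "a = b" by simp
  qed
  have "value_entropy (itinerary f (cell P) n) = - (\<Sum>a\<in>?W. prob (Q a) * log 2 (prob (Q a)))"
    unfolding value_entropy_sum[OF measurable_itinerary[OF f measurable_cell[OF P sp] P'(2)] fin]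
    by (intro arg_cong[where f = uminus] sum.cong refl) (simp only: Q)
  \<comment> \<open>Words with empty fibre contribute zero, matching the removal of
    \<open>{}\<close> from the join.\<close>
  also have "(\<Sum>a\<in>?W. prob (Q a) * log 2 (prob (Q a)))
      = (\<Sum>a\<in>{a \<in> ?W. Q a \<noteq> {}}. prob (Q a) * log 2 (prob (Q a)))"
    using fin by (intro sum.mono_neutral_right) auto
  also have "\<dots> = (\<Sum>C\<in>Q ` {a \<in> ?W. Q a \<noteq> {}}. prob C * log 2 (prob C))"
    using inj by (simp add: sum.reindex)
  also have "Q ` {a \<in> ?W. Q a \<noteq> {}} = partition_join f P n"
    unfolding partition_join_eq[OF P'(1)] Q_def by blast
  finally show ?thesis by (simp add: partition_entropy_def)
qed

section \<open>Regularity of Borel measures and separation of cells\<close>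

text \<open>Induction over the generation of the Borel sets from closed sets. With \<open>F\<close>
  and \<open>U\<close> carried along together, complements merely exchange their roles.\<close>

lemma closed_open_approximation:
  fixes M :: "'a::metric_space measure"
  assumes M: "sets M = sets borel" "finite_measure M" and "B \<in> sets borel" and "e > 0"
  shows "\<exists>F U. closed F \<and> open U \<and> F \<subseteq> B \<and> B \<subseteq> U \<and> measure M (U - F) < e"
proof -
  interpret finite_measure M by fact
  have [measurable]: "closed F \<Longrightarrow> F \<in> sets M" "open F \<Longrightarrow> F \<in> sets M" for F
    by (auto simp: M)
  have "B \<in> sigma_sets UNIV {F. closed F}"
    using assms(3) by (simp add: borel_eq_closed)
  then show ?thesis using \<open>e > 0\<close>
  proof (induction arbitrary: e rule: sigma_sets.induct)
    case (Basic B)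
    then have B: "closed B" by simp
    show ?case
    \<comment> \<open>\<open>infdist x {} = 0\<close>, so the neighbourhoods used below would not
      shrink to the empty set.\<close>
    proof (cases "B = {}")
      case True
      then show ?thesis using Basic by (intro exI[of _ "{}"]) auto
    next
      case False
      define U where "U n = {x. infdist x B < 1 / real (Suc n)}" for n
      have op: "open (U n)" for n
        unfolding U_def by (intro open_Collect_less continuous_intros)
      have dec: "decseq U"
      proof (rule decseq_SucI, unfold U_def, safe)
        fix n x assume "infdist x B < 1 / real (Suc (Suc n))"
        also have "\<dots> \<le> 1 / real (Suc n)" by (simp add: frac_le)
        finally show "infdist x B < 1 / real (Suc n)" .
      qed
      have "x \<in> B" if "x \<in> (\<Inter>n. U n)" for x
      proof (rule ccontr)
        assume "x \<notin> B"
        then have "infdist x B > 0" using B False by (simp add: infdist_pos_not_in_closed)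
        then obtain n where "1 / real (Suc n) < infdist x B"
          using nat_approx_posE by blast
        then show False using that by (auto simp: U_def dest: spec[of _ n])
      qed
      moreover have "B \<subseteq> U n" for n by (auto simp: U_def)
      ultimately have Int: "(\<Inter>n. U n) = B" by blast
      have "(\<lambda>n. measure M (U n)) \<longlonglongrightarrow> measure M (\<Inter>n. U n)"
        using dec op by (intro finite_Lim_measure_decseq) auto
      then have "\<forall>\<^sub>F n in sequentially. measure M (U n) < measure M B + e"
        using Int Basic by (intro order_tendstoD(2)[where y = "measure M B"]) auto
      then obtain n where n: "measure M (U n) < measure M B + e"
        by (auto simp: eventually_sequentially)
      have "measure M (U n - B) = measure M (U n) - measure M B"
        using \<open>B \<subseteq> U n\<close> op B by (intro finite_measure_Diff) auto
      then show ?thesis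
        using n B op[of n] \<open>B \<subseteq> U n\<close> by (intro exI[of _ B] exI[of _ "U n"]) auto
    qed
  next
    case Empty
    then show ?case by (intro exI[of _ "{}"]) auto
  next
    case (Compl B)
    then obtain F U where FU: "closed F" "open U" "F \<subseteq> B" "B \<subseteq> U" "measure M (U - F) < e"
      using Compl.IH[OF Compl.prems] by (elim exE conjE)
    have "(- F) - (- U) = U - F" by auto
    then have "measure M (- F - (- U)) < e" using FU by simp
    then show ?case using FU by (intro exI[of _ "- U"] exI[of _ "- F"]) auto
  next
    case (Union A)
    \<comment> \<open>These tolerances add up to \<open>e / 2\<close>; the other half pays for
      passing to finitely many \<open>F n\<close>.\<close>
    have "\<exists>F U. closed F \<and> open U \<and> F \<subseteq> A n \<and> A n \<subseteq> U \<and> measure M (U - F) < (e / 2) * (1 / 2) ^ Suc n" for n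
      using Union.prems by (intro Union.IH) auto
    then obtain F U where FU: "\<And>n. closed (F n)" "\<And>n. open (U n)" "\<And>n. F n \<subseteq> A n" "\<And>n. A n \<subseteq> U n"
      "\<And>n. measure M (U n - F n) < (e / 2) * (1 / 2) ^ Suc n" by metis
    define V where "V = (\<Union>n. U n)"
    have "open V" using FU by (auto simp: V_def)
    have [measurable]: "V \<in> sets M" "\<And>n. F n \<in> sets M" "\<And>n. U n \<in> sets M"
      using FU \<open>open V\<close> by auto
    have geo: "(\<lambda>n. (e / 2) * (1 / 2) ^ Suc n) sums (e / 2)"
      using sums_mult[OF power_half_series, of "e / 2"] by simp
    have summ: "summable (\<lambda>n. measure M (U n - F n))"
      using FU(5) by (intro summable_comparison_test'[OF sums_summable[OF geo], of 0]) (auto intro: less_imp_le)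
    have "measure M (\<Union>n. U n - F n) \<le> (\<Sum>n. measure M (U n - F n))"
      using summ by (intro finite_measure_subadditive_countably) auto
    also have "\<dots> \<le> (\<Sum>n. (e / 2) * (1 / 2) ^ Suc n)"
      by (rule suminf_le[OF less_imp_le[OF FU(5)] summ sums_summable[OF geo]])
    also have "\<dots> = e / 2" by (rule sums_unique[OF geo, symmetric])
    finally have 1: "measure M (\<Union>n. U n - F n) \<le> e / 2" .
    have "measure M (V - (\<Union>n. F n)) \<le> measure M (\<Union>n. U n - F n)"
      by (intro finite_measure_mono) (auto simp: V_def)
    with 1 have 2: "measure M (V - (\<Union>n. F n)) \<le> e / 2" by simp
    \<comment> \<open>The union of all \<open>F n\<close> need not be closed, but finite unions are;
      \<open>D n\<close> decreases to a set of measure at most \<open>e / 2\<close>.\<close>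
    define D where "D n = V - (\<Union>i\<le>n. F i)" for n
    have D: "decseq D"
      unfolding D_def by (intro decseq_SucI Diff_mono UN_mono) auto
    have "(\<lambda>n. measure M (D n)) \<longlonglongrightarrow> measure M (\<Inter>n. D n)"
      by (intro finite_Lim_measure_decseq[OF _ D]) (auto simp: D_def)
    moreover have "(\<Inter>n. D n) = V - (\<Union>n. F n)" by (auto simp: D_def)
    ultimately have "\<forall>\<^sub>F n in sequentially. measure M (D n) < e"
      using 2 Union.prems by (intro order_tendstoD(2)[where y = "measure M (V - (\<Union>n. F n))"]) auto
    then obtain n where n: "measure M (V - (\<Union>i\<le>n. F i)) < e"
      by (auto simp: eventually_sequentially D_def)
    have "closed (\<Union>i\<le>n. F i)" by (intro closed_UN FU(1) ballI) simp
    moreover have "(\<Union>i\<le>n. F i) \<subseteq> (\<Union>n. A n)" by (rule UN_mono[OF subset_UNIV FU(3)])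
    moreover have "(\<Union>n. A n) \<subseteq> V" unfolding V_def by (rule UN_mono[OF subset_refl FU(4)])
    ultimately show ?case using n \<open>open V\<close> by blast
  qed
qed

text \<open>The library version \<open>separate_compact_closed\<close> requires the type class \<open>heine_borel\<close>.\<close>

lemma compact_closed_dist_lower_bound:
  fixes S T :: "'a::metric_space set"
  assumes "compact S" "closed T" "S \<inter> T = {}"
  shows "\<exists>d>0. \<forall>x\<in>S. \<forall>y\<in>T. d \<le> dist x y"
proof (cases "S = {} \<or> T = {}")
  case True
  then show ?thesis by (intro exI[of _ 1]) auto
next
  case False
  then obtain x where x: "x \<in> S" "\<And>y. y \<in> S \<Longrightarrow> infdist x T \<le> infdist y T"
    using continuous_attains_inf[OF assms(1) _ continuous_on_infdist[OF continuous_on_id], of T] by auto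
  have "infdist x T > 0" using False assms x(1) by (intro infdist_pos_not_in_closed) auto
  moreover have "infdist x T \<le> dist y z" if "y \<in> S" "z \<in> T" for y z
    using x(2)[OF that(1)] infdist_le[OF that(2), of y] by linarith
  ultimately show ?thesis by blast
qed

text \<open>Each cell has a closed, hence compact, core that misses little mass, and
  \<open>N\<close> collects what the cores miss. Distinct cores are a positive distance apart, so an
  approximation of a core point reveals its cell.\<close>

lemma cell_recognisable_from_approximation:
  fixes M :: "'a::metric_space measure"
  assumes cpt: "compact (UNIV :: 'a set)" and M: "sets M = sets borel" "finite_measure M"
    and P: "finite_measurable_partition M P" and "\<eta> > 0"
  shows "\<exists>g d N. d > 0 \<and> N \<in> sets M \<and> measure M N \<le> \<eta> \<and>
    (\<forall>x y. x \<notin> N \<longrightarrow> dist x y < d \<longrightarrow> g y = cell P x)"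
proof -
  interpret finite_measure M by fact
  have sp: "space M = UNIV" using M sets_eq_imp_space_eq by fastforce
  have P': "partition_on UNIV P" "finite P" "P \<subseteq> sets M"
    using P sp by (auto simp: finite_measurable_partition_def)
  have "P \<noteq> {}" using cell_in[OF P'(1)] by blast
  then have card: "real (card P) > 0" using P' by (simp add: card_gt_0_iff)
  have "\<exists>K. closed K \<and> K \<subseteq> A \<and> measure M (A - K) < \<eta> / real (card P)" if A: "A \<in> P" for A
  proof -
    have "A \<in> sets borel" using P' A M by auto
    then obtain F U where FU: "closed F" "open U" "F \<subseteq> A" "A \<subseteq> U" "measure M (U - F) < \<eta> / real (card P)"
      using closed_open_approximation[OF M, of A "\<eta> / real (card P)"] \<open>\<eta> > 0\<close> card by auto
    have "U - F \<in> sets M" using FU M by (auto intro: sets.Diff)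
    then have "measure M (A - F) \<le> measure M (U - F)"
      using FU by (intro finite_measure_mono) auto
    then show ?thesis using FU by (intro exI[of _ F]) auto
  qed
  then obtain K where K: "\<And>A. A \<in> P \<Longrightarrow> closed (K A)" "\<And>A. A \<in> P \<Longrightarrow> K A \<subseteq> A"
    "\<And>A. A \<in> P \<Longrightarrow> measure M (A - K A) < \<eta> / real (card P)" by metis
  have comp: "compact (K A)" if "A \<in> P" for A
    using compact_Int_closed[OF cpt K(1)[OF that]] by simp
  have "\<exists>d>0. \<forall>x\<in>K A. \<forall>y\<in>(\<Union>B\<in>P - {A}. K B). d \<le> dist x y" if A: "A \<in> P" for A
  proof (rule compact_closed_dist_lower_bound[OF comp[OF A]])
    show "closed (\<Union>B\<in>P - {A}. K B)" using P' K(1) by (intro closed_UN) auto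
    have "K A \<inter> K B = {}" if "B \<in> P - {A}" for B
    proof -
      have "A \<inter> B = {}" using partition_onD2[OF P'(1)] A that by (auto simp: disjoint_def)
      then show ?thesis using K(2)[OF A] K(2)[of B] that by blast
    qed
    then show "K A \<inter> (\<Union>B\<in>P - {A}. K B) = {}" by blast
  qed
  then obtain s where s: "\<And>A. A \<in> P \<Longrightarrow> s A > 0"
    "\<And>A x y. A \<in> P \<Longrightarrow> x \<in> K A \<Longrightarrow> y \<in> (\<Union>B\<in>P - {A}. K B) \<Longrightarrow> s A \<le> dist x y" by metis
  \<comment> \<open>Half the least separation: points of two cores within \<open>d\<close> of the
    same \<open>y\<close> are less than \<open>2 * d\<close> apart.\<close>
  define d where "d = Min (s ` P) / 2"
  have "d > 0" using s(1) P' \<open>P \<noteq> {}\<close> by (simp add: d_def)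
  have d: "2 * d \<le> s A" if "A \<in> P" for A using P' that by (simp add: d_def)
  define N where "N = (\<Union>A\<in>P. A - K A)"
  have AK: "A - K A \<in> sets M" if "A \<in> P" for A
    using P' K(1)[OF that] that M by (intro sets.Diff) auto
  have "measure M N \<le> (\<Sum>A\<in>P. measure M (A - K A))"
    unfolding N_def using P'(2) AK by (intro finite_measure_subadditive_finite) auto
  also have "\<dots> \<le> (\<Sum>A\<in>P. \<eta> / real (card P))"
    using K(3) by (intro sum_mono) (auto intro: less_imp_le)
  also have "\<dots> = \<eta>" using card by simp
  finally have "measure M N \<le> \<eta>" .
  moreover have "N \<in> sets M" unfolding N_def using AK P'(2) by (intro sets.finite_UN) auto
  moreover define g where "g y = (SOME A. A \<in> P \<and> (\<exists>x\<in>K A. dist x y < d))" for y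
  have "g y = cell P x" if x: "x \<notin> N" "dist x y < d" for x y
    unfolding g_def
  proof (rule some_equality)
    have xK: "x \<in> K (cell P x)"
      using x(1) cell_in[OF P'(1), of x] in_cell[OF P'(1), of x] by (auto simp: N_def)
    then show "cell P x \<in> P \<and> (\<exists>z\<in>K (cell P x). dist z y < d)"
      using x(2) cell_in[OF P'(1)] by blast
    fix B assume "B \<in> P \<and> (\<exists>z\<in>K B. dist z y < d)"
    then obtain z where B: "B \<in> P" and z: "z \<in> K B" "dist z y < d" by blast
    show "B = cell P x"
    proof (rule ccontr)
      assume "B \<noteq> cell P x"
      then have "z \<in> (\<Union>B\<in>P - {cell P x}. K B)" using B z by blast
      then have "s (cell P x) \<le> dist x z" by (rule s(2)[OF cell_in[OF P'(1)] xK])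
      also have "dist x z \<le> dist x y + dist z y" by (rule dist_triangle2)
      also have "\<dots> < 2 * d" using x z by simp
      finally show False using d[OF cell_in[OF P'(1), of x]] by simp
    qed
  qed
  ultimately show ?thesis using \<open>d > 0\<close> by blast
qed

section \<open>Entropy and channel capacity\<close>

text \<open>\<open>Y\<close> may take infinitely many values; splitting by the value of
  \<open>X\<close> keeps the union finite.\<close>

lemma sets_mismatch:
  assumes X: "X \<in> measurable M (count_space S)" "finite S" and Y: "Y \<in> measurable M (count_space UNIV)"
  shows "{x \<in> space M. X x \<noteq> Y x} \<in> sets M"
proof -
  have "{x \<in> space M. X x \<noteq> Y x} = (\<Union>s\<in>S. (X -` {s} \<inter> space M) \<inter> (Y -` (- {s}) \<inter> space M))"
    using measurable_space[OF X(1)] by auto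
  also have "\<dots> \<in> sets M"
    using X(2) by (intro sets.finite_UN sets.Int measurable_sets[OF X(1)] measurable_sets[OF Y]) auto
  finally show ?thesis .
qed

text \<open>A window can reach back to negative times, where \<open>inv f\<close> is iterated; both
  directions are continuous.\<close>

lemma measurable_coded_symbol:
  fixes f :: "'a::topological_space \<Rightarrow> 'a"
  assumes M: "sets M = sets borel" and f: "homeomorphism UNIV UNIV f (inv f)"
    and pol: "admissible_policy A k \<delta> \<gamma>"
  shows "(\<lambda>x. coded_symbol f k \<delta> x t) \<in> measurable M (count_space A)"
proof -
  have cf: "continuous_on UNIV (g ^^ n)" if "continuous_on UNIV g" for g :: "'a \<Rightarrow> 'a" and n
  proof (induction n)
    case (Suc n)
    then show ?case unfolding funpow.simps
      by (intro continuous_on_compose Suc) (rule continuous_on_subset[OF that subset_UNIV])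
  qed simp
  have "continuous_on UNIV (int_iterate f s)" for s
    using f by (simp add: int_iterate_def homeomorphism_def cf)
  then have "int_iterate f s \<in> measurable M borel" for s
    using borel_measurable_continuous_onI M by (metis measurable_cong_sets)
  then have "(\<lambda>x. window k (\<lambda>s. int_iterate f s x) t) \<in> measurable M (\<Pi>\<^sub>M i\<in>{..<k}. borel)"
    unfolding window_def by (intro measurable_restrict) auto
  then show ?thesis
    unfolding coded_symbol_def
    by (rule measurable_compose) (use pol in \<open>simp add: admissible_policy_def\<close>)
qed

text \<open>Blocks of symbols range over a finite set, so any \<open>\<gamma>\<close> is measurable.
  The discrete target allows composition with an arbitrary \<open>g\<close> later.\<close>

lemma measurable_state_estimate:
  fixes f :: "'a::topological_space \<Rightarrow> 'a"
  assumes "sets M = sets borel" "homeomorphism UNIV UNIV f (inv f)"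
    and "admissible_policy A k \<delta> \<gamma>" "finite A"
  shows "(\<lambda>x. state_estimate f k \<delta> \<gamma> x t) \<in> measurable M (count_space UNIV)"
proof -
  have "(\<lambda>x. window k (coded_symbol f k \<delta> x) t) \<in> measurable M (count_space (\<Pi>\<^sub>E i\<in>{..<k}. A))"
    unfolding window_def using assms by (intro measurable_finite_word measurable_coded_symbol)
  then show ?thesis unfolding state_estimate_def by (rule measurable_compose) simp
qed

section \<open>From counting codewords to the capacity bound\<close>

text \<open>The codewords are the decoded estimates at times \<open>T\<close> to
  \<open>T + n - 1\<close>. They are functions of \<open>n + k\<close> symbols, hence at most
  \<open>card A ^ (n + k)\<close> in number.\<close>

lemma value_entropy_itinerary_le_capacity:
  fixes f :: "'a::topological_space \<Rightarrow> 'a" and \<phi> g :: "'a \<Rightarrow> 'b"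
  assumes M: "prob_space M" "sets M = sets borel"
    and f: "homeomorphism UNIV UNIV f (inv f)" "f \<in> measurable M M" "distr M M f = M"
    and pol: "admissible_policy A k \<delta> \<gamma>" and A: "finite A" "A \<noteq> {}"
    and \<phi>: "\<phi> \<in> measurable M (count_space S)" and S: "finite S" "S \<noteq> {}"
    and err: "\<And>t. t \<ge> T \<Longrightarrow>
      measure M {x \<in> space M. \<phi> ((f ^^ t) x) \<noteq> g (state_estimate f k \<delta> \<gamma> x (int t))} \<le> e"
    and \<theta>: "0 < \<theta>" "\<theta> < 1"
  shows "prob_space.value_entropy M (itinerary f \<phi> n) \<le>
    real (n + k) * log 2 (real (card A)) + real n * (- log 2 (1 - \<theta>) + e * log 2 (real (card S) / \<theta>))"
proof -
  interpret prob_space M by fact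
  define X where "X i x = \<phi> ((f ^^ (T + i)) x)" for i x
  define Y where "Y i x = g (state_estimate f k \<delta> \<gamma> x (int (T + i)))" for i x
  define decode where
    "decode q = (\<lambda>i\<in>{..<n}. g (\<gamma> (int (T + i)) (\<lambda>j\<in>{..<k}. q (i + j))))" for q
  define Q where "Q = (\<Pi>\<^sub>E i\<in>{..<n + k}. A)"
  have finQ: "finite Q" unfolding Q_def using A by (intro finite_PiE) auto
  have cs: "coded_symbol f k \<delta> x t \<in> A" if "x \<in> space M" for x t
    using measurable_space[OF measurable_coded_symbol[OF M(2) f(1) pol] that] by simp
  have Y: "(\<lambda>i\<in>{..<n}. Y i x) \<in> decode ` Q" if x: "x \<in> space M" for x
  proof
    \<comment> \<open>It covers the times \<open>T - k + 1\<close> to \<open>T + n\<close>: the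
      block read at time \<open>T + i\<close> begins at index \<open>i\<close>, and the last entry
      lies one step after the last estimate.\<close>
    let ?q = "window (n + k) (coded_symbol f k \<delta> x) (int (T + n))"
    show "?q \<in> Q" unfolding Q_def window_def using cs[OF x] by simp
    show "(\<lambda>i\<in>{..<n}. Y i x) = decode ?q"
      unfolding decode_def
    proof (rule restrict_ext)
      fix i assume i: "i \<in> {..<n}"
      have "(\<lambda>j\<in>{..<k}. ?q (i + j)) = window k (coded_symbol f k \<delta> x) (int (T + i))"
        unfolding window_def
      proof (rule restrict_ext)
        fix j assume "j \<in> {..<k}"
        then have "i + j < n + k" using i by simp
        moreover have "int (T + n) - int (n + k) + 1 + int (i + j) = int (T + i) - int k + 1 + int j"
          by simp
        ultimately show "(\<lambda>l\<in>{..<n + k}. coded_symbol f k \<delta> x (int (T + n) - int (n + k) + 1 + int l)) (i + j)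
            = coded_symbol f k \<delta> x (int (T + i) - int k + 1 + int j)"
          by (simp only: restrict_apply lessThan_iff if_True)
      qed
      then show "Y i x = g (\<gamma> (int (T + i)) (\<lambda>j\<in>{..<k}. ?q (i + j)))"
        by (simp only: Y_def state_estimate_def)
    qed
  qed
  have mX: "X i \<in> measurable M (count_space S)" for i
    unfolding X_def[abs_def] by (rule measurable_compose[OF measurable_funpow[OF f(2)] \<phi>])
  have mY: "Y i \<in> measurable M (count_space UNIV)" for i
    unfolding Y_def[abs_def]
    by (rule measurable_compose[OF measurable_state_estimate[OF M(2) f(1) pol A(1)]]) simp
  \<comment> \<open>The error bound holds from time \<open>T\<close> on, and invariance moves the
    itinerary there.\<close>
  have "value_entropy (itinerary f \<phi> n) = value_entropy (\<lambda>x. itinerary f \<phi> n ((f ^^ T) x))"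
    by (rule value_entropy_funpow[OF f(2,3) measurable_itinerary[OF f(2) \<phi> S(1)] finite_PiE, symmetric])
      (simp_all add: S)
  also have "(\<lambda>x. itinerary f \<phi> n ((f ^^ T) x)) = (\<lambda>x. \<lambda>i\<in>{..<n}. X i x)"
    by (intro ext) (simp add: itinerary_def X_def add.commute[of T] funpow_add cong: restrict_cong)
  also have "value_entropy \<dots> \<le> log 2 (real (card (decode ` Q))) +
      real n * (- log 2 (1 - \<theta>) + e * log 2 (real (card S) / \<theta>))"
  proof (rule value_entropy_le_codewords[where Y = Y and E = "\<lambda>i. {x \<in> space M. X i x \<noteq> Y i x}"])
    show "prob {x \<in> space M. X i x \<noteq> Y i x} \<le> e" for i
      unfolding X_def Y_def by (rule err) simp
  qed (use mX S finQ Y \<theta> sets_mismatch[OF mX S(1) mY] in auto)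
  also have "log 2 (real (card (decode ` Q))) \<le> log 2 (real (card A ^ (n + k)))"
  proof -
    have "decode ` Q \<noteq> {}" using Y not_empty by blast
    then have "card (decode ` Q) > 0" using finQ by (simp add: card_gt_0_iff)
    moreover have "card (decode ` Q) \<le> card A ^ (n + k)"
      using card_image_le[OF finQ, of decode] by (simp add: Q_def card_PiE)
    moreover have "card A > 0" using A by (simp add: card_gt_0_iff)
    ultimately show ?thesis by (subst log_le_cancel_iff) (auto simp del: of_nat_power)
  qed
  also have "log 2 (real (card A ^ (n + k))) = real (n + k) * log 2 (real (card A))"
    using A by (simp add: log_nat_power card_gt_0_iff)
  finally show ?thesis by simp
qed

text \<open>\<open>\<epsilon>\<close> is fixed before the policy. One \<open>\<zeta>\<close> pays
  for right letters and one for wrong letters.\<close>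

lemma entropy_wrt_partition_le_capacity:
  fixes f :: "'a::metric_space \<Rightarrow> 'a"
  assumes cpt: "compact (UNIV :: 'a set)" and f: "homeomorphism UNIV UNIV f (inv f)" and p: "p > 0"
    and M: "prob_space M" "sets M = sets borel" "invariant_measure f M"
    and P: "finite_measurable_partition M P" and \<zeta>: "\<zeta> > 0"
  shows "\<exists>\<epsilon>>0. \<forall>A. achieving_alphabet M f p \<epsilon> A \<longrightarrow>
    entropy_wrt_partition M f P \<le> log 2 (real (card A)) + 2 * \<zeta>"
proof -
  interpret prob_space M by fact
  have sp: "space M = UNIV" using M(2) sets_eq_imp_space_eq by fastforce
  have fm: "f \<in> measurable M M" "distr M M f = M" using M(3) by (auto simp: invariant_measure_def)
  have P': "partition_on UNIV P" "finite P"
    using P sp by (auto simp: finite_measurable_partition_def)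
  have "P \<noteq> {}" using cell_in[OF P'(1)] by blast
  note mc = measurable_cell[OF P sp]
  \<comment> \<open>Makes the bound on the cost of a right letter equal to
    \<open>\<zeta>\<close>.\<close>
  define \<theta> where "\<theta> = 1 - 2 powr (- \<zeta>)"
  have "2 powr (- \<zeta>) < 2 powr 0" using \<zeta> by (intro powr_less_mono) auto
  then have \<theta>: "0 < \<theta>" "\<theta> < 1" "- log 2 (1 - \<theta>) = \<zeta>" by (simp_all add: \<theta>_def)
  define K where "K = log 2 (real (card P) / \<theta>)"
  have "real (card P) \<ge> 1" using P' \<open>P \<noteq> {}\<close> by (simp add: Suc_le_eq card_gt_0_iff)
  then have "K \<ge> 0" using \<theta> by (simp add: K_def)
  \<comment> \<open>Mismatches will have probability at most \<open>2 * \<eta>\<close> and cost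
    \<open>K\<close> each; \<open>K + 1\<close> avoids a division by zero.\<close>
  define \<eta> where "\<eta> = \<zeta> / (2 * (K + 1))"
  have "\<eta> > 0" using \<zeta> \<open>K \<ge> 0\<close> by (simp add: \<eta>_def)
  have \<eta>K: "2 * \<eta> * K \<le> \<zeta>" using \<zeta> \<open>K \<ge> 0\<close> by (simp add: \<eta>_def field_simps)
  obtain g d N where d: "d > 0" and N: "N \<in> sets M" "prob N \<le> \<eta>"
    and g: "\<And>x y. x \<notin> N \<Longrightarrow> dist x y < d \<Longrightarrow> g y = cell P x"
    using cell_recognisable_from_approximation[OF cpt M(2) finite_measure_axioms P \<open>\<eta> > 0\<close>] by metis
  \<comment> \<open>By Markov's inequality, a mean error below \<open>2 * \<epsilon>\<close> leaves
    probability at most \<open>\<eta>\<close> for a distance of at least \<open>d\<close>.\<close>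
  define \<epsilon> where "\<epsilon> = \<eta> * d powr p / 2"
  have "\<epsilon> > 0" using \<open>\<eta> > 0\<close> d by (simp add: \<epsilon>_def)
  have "entropy_wrt_partition M f P \<le> log 2 (real (card A)) + 2 * \<zeta>"
    if ach: "achieving_alphabet M f p \<epsilon> A" for A
  proof -
    obtain k \<delta> \<gamma> where A: "finite A" "A \<noteq> {}" and pol: "admissible_policy A k \<delta> \<gamma>"
      and obj: "achieves_objective M f p \<epsilon> k \<delta> \<gamma>"
      using ach unfolding achieving_alphabet_def by blast
    define I where
      "I t = (\<integral>\<^sup>+ x. ennreal (dist (int_iterate f t x) (state_estimate f k \<delta> \<gamma> x t) powr p) \<partial>M)" for t
    \<comment> \<open>A bound on the limsup controls the integrals eventually only up to a strictly
      larger constant.\<close>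
    have "ennreal \<epsilon> < ennreal (2 * \<epsilon>)" using \<open>\<epsilon> > 0\<close> by (simp add: ennreal_less_iff)
    then have "Limsup at_top I < ennreal (2 * \<epsilon>)"
      using obj unfolding achieves_objective_def I_def by (rule le_less_trans[rotated])
    then have "\<forall>\<^sub>F t in at_top. I t < ennreal (2 * \<epsilon>)" by (rule Limsup_lessD)
    then obtain t0 where t0: "\<And>t. t \<ge> t0 \<Longrightarrow> I t < ennreal (2 * \<epsilon>)"
      unfolding eventually_at_top_linorder by blast
    \<comment> \<open>A wrong letter has two possible causes: the state lies in \<open>N\<close>,
      whose preimage has the same measure by invariance, or the estimate is at least
      \<open>d\<close> away.\<close>
    have err: "prob {x \<in> space M. cell P ((f ^^ t) x) \<noteq> g (state_estimate f k \<delta> \<gamma> x (int t))} \<le> 2 * \<eta>"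
      if t: "t \<ge> nat t0" for t
    proof -
      let ?E = "{x \<in> space M. cell P ((f ^^ t) x) \<noteq> g (state_estimate f k \<delta> \<gamma> x (int t))}"
      let ?N = "(f ^^ t) -` N \<inter> space M"
      have E: "?E \<in> sets M"
        by (rule sets_mismatch[OF measurable_compose[OF measurable_funpow[OF fm(1)] mc] P'(2)])
          (rule measurable_compose[OF measurable_state_estimate[OF M(2) f pol A(1)]], simp)
      have Nm: "?N \<in> sets M" by (rule measurable_sets[OF measurable_funpow[OF fm(1)] N(1)])
      have "distr M M (f ^^ t) = M"
      proof (induction t)
        case (Suc t)
        have "distr M M (f ^^ Suc t) = distr (distr M M (f ^^ t)) M f"
          by (simp add: distr_distr[OF fm(1) measurable_funpow[OF fm(1)]])
        then show ?case unfolding Suc.IH fm(2) .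
      qed (simp add: distr_id)
      then have "prob ?N = prob N"
        using measure_distr[OF measurable_funpow[OF fm(1)] N(1), of t] by simp
      have "ennreal (d powr p) * emeasure M (?E - ?N) = (\<integral>\<^sup>+ x. ennreal (d powr p) * indicator (?E - ?N) x \<partial>M)"
        using E Nm by (intro nn_integral_cmult_indicator[symmetric]) auto
      also have "\<dots> \<le> I (int t)"
        unfolding I_def
      proof (rule nn_integral_mono)
        fix x assume "x \<in> space M"
        show "ennreal (d powr p) * indicator (?E - ?N) x
            \<le> ennreal (dist (int_iterate f (int t) x) (state_estimate f k \<delta> \<gamma> x (int t)) powr p)"
        proof (cases "x \<in> ?E - ?N")
          case True
          then have "(f ^^ t) x \<notin> N" "cell P ((f ^^ t) x) \<noteq> g (state_estimate f k \<delta> \<gamma> x (int t))" by auto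
          then have "d \<le> dist ((f ^^ t) x) (state_estimate f k \<delta> \<gamma> x (int t))"
            using g by (metis not_less)
          then have "d powr p \<le> dist ((f ^^ t) x) (state_estimate f k \<delta> \<gamma> x (int t)) powr p"
            using d p by (intro powr_mono2) auto
          then show ?thesis
            by (simp add: indicator_eq_1_iff[THEN iffD2, OF True] int_iterate_def ennreal_leI)
        qed simp
      qed
      also have "\<dots> < ennreal (2 * \<epsilon>)" using t by (intro t0) linarith
      also have "\<dots> = ennreal (d powr p) * ennreal \<eta>"
        using d \<open>\<eta> > 0\<close> by (simp add: \<epsilon>_def ennreal_mult' mult.commute)
      finally have "ennreal (d powr p * prob (?E - ?N)) < ennreal (d powr p * \<eta>)"
        using d \<open>\<eta> > 0\<close> by (simp add: emeasure_eq_measure ennreal_mult')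
      then have "prob (?E - ?N) \<le> \<eta>"
        using d by (simp add: ennreal_less_iff)
      moreover have "prob ?E \<le> prob (?E - ?N) + prob ?N"
      proof -
        have "prob ?E \<le> prob ((?E - ?N) \<union> ?N)" using E Nm by (intro finite_measure_mono) auto
        also have "\<dots> \<le> prob (?E - ?N) + prob ?N" using E Nm by (intro measure_Un_le) auto
        finally show ?thesis .
      qed
      ultimately show ?thesis using N(2) \<open>prob ?N = prob N\<close> by linarith
    qed
    define L where "L = log 2 (real (card A))"
    have bound: "value_entropy (itinerary f (cell P) n) \<le> real (n + k) * L + real n * (2 * \<zeta>)" for n
    proof -
      have "value_entropy (itinerary f (cell P) n) \<le> real (n + k) * L + real n * (\<zeta> + 2 * \<eta> * K)"
        using value_entropy_itinerary_le_capacity[where T = "nat t0" and n = n,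
            OF M(1,2) f fm pol A mc P'(2) \<open>P \<noteq> {}\<close> err \<theta>(1,2)]
        by (simp add: L_def K_def \<theta>(3))
      also have "\<dots> \<le> real (n + k) * L + real n * (2 * \<zeta>)"
        using \<eta>K by (intro add_left_mono mult_left_mono) auto
      finally show ?thesis .
    qed
    have lim: "(\<lambda>n. value_entropy (itinerary f (cell P) n) / real n) \<longlonglongrightarrow> entropy_wrt_partition M f P"
      using convergent_value_entropy_itinerary[OF fm mc P'(2)]
      by (simp add: entropy_wrt_partition_def partition_entropy_join[OF P sp fm(1)] convergent_LIMSEQ_iff)
    \<comment> \<open>\<open>k\<close> is fixed by the policy, so the overhead of its memory
      vanishes as \<open>n\<close> grows.\<close>
    have bound_lim: "(\<lambda>n. L + real k * L / real n + 2 * \<zeta>) \<longlonglongrightarrow> L + 0 + 2 * \<zeta>"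
      by (intro tendsto_add tendsto_const tendsto_divide_0[OF tendsto_const]
          filterlim_at_top_imp_at_infinity filterlim_real_sequentially)
    have "\<forall>\<^sub>F n in sequentially. value_entropy (itinerary f (cell P) n) / real n
        \<le> L + real k * L / real n + 2 * \<zeta>"
      using eventually_gt_at_top[of 0]
    proof eventually_elim
      case (elim n)
      then show ?case using bound[of n] by (simp add: field_simps)
    qed
    then have "entropy_wrt_partition M f P \<le> L + 0 + 2 * \<zeta>"
      by (rule tendsto_le[OF sequentially_bot bound_lim lim])
    then show ?thesis by (simp add: L_def)
  qed
  then show ?thesis using \<open>\<epsilon> > 0\<close> by blast
qed

theorem theoremV2:
  fixes f :: "'a::metric_space \<Rightarrow> 'a" and M :: "'a measure" and p :: real
  assumes "compact (UNIV :: 'a set)"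
    and "homeomorphism UNIV UNIV f (inv f)"
    and "p > 0"
    and "prob_space M" and "sets M = sets borel"
    and "ergodic_measure f M"
  shows "min_capacity M f p \<ge> metric_entropy M f"
  unfolding metric_entropy_def
proof (rule SUP_least)
  fix P assume "P \<in> {P. finite_measurable_partition M P}"
  then have P: "finite_measurable_partition M P" by simp
  have inv: "invariant_measure f M" using assms(6) by (simp add: ergodic_measure_def)
  show "ereal (entropy_wrt_partition M f P) \<le> min_capacity M f p"
  proof (rule ereal_le_epsilon2)
    fix e :: real assume "e > 0"
    then obtain \<epsilon> where "\<epsilon> > 0"
      and \<epsilon>: "\<And>A. achieving_alphabet M f p \<epsilon> A \<Longrightarrow>
        entropy_wrt_partition M f P \<le> log 2 (real (card A)) + e"
      using entropy_wrt_partition_le_capacity[OF assms(1,2,3,4,5) inv P, of "e / 2"] by auto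
    \<comment> \<open>If no alphabet achieves the objective, the infimum is infinite and the bound
      is trivial.\<close>
    have "ereal (entropy_wrt_partition M f P - e) \<le> min_capacity_eps M f p \<epsilon>"
      unfolding min_capacity_eps_def using \<epsilon> by (intro INF_greatest) (auto simp: algebra_simps)
    \<comment> \<open>\<open>min_capacity_eps\<close> can only grow as its tolerance decreases, so
      the limit dominates its value at \<open>\<epsilon>\<close>.\<close>
    also have "\<dots> \<le> min_capacity M f p"
    proof (rule tendsto_lowerbound[OF tendsto_min_capacity])
      show "\<forall>\<^sub>F \<epsilon>' in at_right 0. min_capacity_eps M f p \<epsilon> \<le> min_capacity_eps M f p \<epsilon>'"
        using \<open>\<epsilon> > 0\<close> min_capacity_eps_antimono[OF less_imp_le] unfolding eventually_at_right_field by blast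
    qed simp
    finally have "ereal (entropy_wrt_partition M f P - e) + ereal e \<le> min_capacity M f p + ereal e"
      by (rule add_right_mono)
    then show "ereal (entropy_wrt_partition M f P) \<le> min_capacity M f p + ereal e" by simp
  qed
qed

end
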